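(* Let $A$ be a ring and $M$ an $A$-module, with $A$ and $A(+)M$ Marot rings, and set $S=A\setminus(Z(A)\cup Z(M))$. Then $A(+)M$ is an SP-ring if and only if both of the following hold: every ideal $I$ of $A$ with $I\cap S\neq\emptyset$ is a product of radical ideals of $A$, and $sM=M$ for each $s\in S$.
   Context: All rings are commutative with $1$. A regular element is a non-zerodivisor, and a regular ideal is an ideal containing a regular element. A Marot ring is a ring in which every regular ideal is generated by regular elements. An ideal $I$ is radical if $\sqrt{I}=I$ (the whole ring counts as a radical ideal). An SP-ring is a ring in which every regular ideal is a (finite) product of radical ideals. The idealization $A(+)M$ is the ring with additive group $A\oplus M$ and multiplication $(a,x)(b,y)=(ab,ay+bx)$ for $a,b\in A$, $x,y\in M$. $Z(A)$ is the set of zerodivisors of $A$, and $Z(M)$ is the set of zerodivisors on $M$, i.e. the $a\in A$ with $ax=0$ for some nonzero $x\in M$. *)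

theory Defs
  imports "HOL-Algebra.Module" "HOL-Algebra.Ideal_Product"
begin

text \<open>A zerodivisor annihilates some nonzero element; hence \<open>0\<close> is a zerodivisor exactly when the
  ring (or the module) is nonzero.\<close>

definition zerodivisors :: "('a, 'm) ring_scheme \<Rightarrow> 'a set" where
  "zerodivisors R =
    {a \<in> carrier R. \<exists>b \<in> carrier R. b \<noteq> \<zero>\<^bsub>R\<^esub> \<and> a \<otimes>\<^bsub>R\<^esub> b = \<zero>\<^bsub>R\<^esub>}"

definition module_zerodivisors ::
    "('a, 'm) ring_scheme \<Rightarrow> ('a, 'b, 'n) module_scheme \<Rightarrow> 'a set" where
  "module_zerodivisors R M =
    {a \<in> carrier R. \<exists>x \<in> carrier M. x \<noteq> \<zero>\<^bsub>M\<^esub> \<and> a \<odot>\<^bsub>M\<^esub> x = \<zero>\<^bsub>M\<^esub>}"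

definition regular_elements :: "('a, 'm) ring_scheme \<Rightarrow> 'a set" where
  "regular_elements R = carrier R - zerodivisors R"

definition regular_ideal :: "'a set \<Rightarrow> ('a, 'm) ring_scheme \<Rightarrow> bool" where
  "regular_ideal I R \<longleftrightarrow> ideal I R \<and> I \<inter> regular_elements R \<noteq> {}"

definition ideal_radical :: "('a, 'm) ring_scheme \<Rightarrow> 'a set \<Rightarrow> 'a set" where
  "ideal_radical R I = {a \<in> carrier R. \<exists>n::nat. n > 0 \<and> a [^]\<^bsub>R\<^esub> n \<in> I}"

definition radical_ideal :: "'a set \<Rightarrow> ('a, 'm) ring_scheme \<Rightarrow> bool" where
  "radical_ideal I R \<longleftrightarrow> ideal I R \<and> ideal_radical R I = I"

text \<open>The empty product is the whole ring, which is itself a radical ideal, so admitting the empty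
  list adds no new products.\<close>

definition product_of_radical_ideals :: "'a set \<Rightarrow> ('a, 'm) ring_scheme \<Rightarrow> bool" where
  "product_of_radical_ideals I R \<longleftrightarrow>
    (\<exists>Js. (\<forall>J \<in> set Js. radical_ideal J R) \<and> I = foldr (ideal_prod R) Js (carrier R))"

locale marot_ring = cring +
  assumes regular_ideal_generated:
    "regular_ideal I R \<Longrightarrow> \<exists>X \<subseteq> regular_elements R. I = Idl X"

locale SP_ring = cring +
  assumes regular_ideal_product: "regular_ideal I R \<Longrightarrow> product_of_radical_ideals I R"

definition idealization ::
    "('a, 'm) ring_scheme \<Rightarrow> ('a, 'b, 'n) module_scheme \<Rightarrow> ('a \<times> 'b) ring" where
  "idealization A M =
    \<lparr> carrier = carrier A \<times> carrier M,
      mult = (\<lambda>(a, x) (b, y). (a \<otimes>\<^bsub>A\<^esub> b, (a \<odot>\<^bsub>M\<^esub> y) \<oplus>\<^bsub>M\<^esub> (b \<odot>\<^bsub>M\<^esub> x))),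
      one = (\<one>\<^bsub>A\<^esub>, \<zero>\<^bsub>M\<^esub>),
      zero = (\<zero>\<^bsub>A\<^esub>, \<zero>\<^bsub>M\<^esub>),
      add = (\<lambda>(a, x) (b, y). (a \<oplus>\<^bsub>A\<^esub> b, x \<oplus>\<^bsub>M\<^esub> y)) \<rparr>"

lemma (in module) cring_idealization: "cring (idealization R M)"
proof (rule cringI)
  show "abelian_group (idealization R M)"
  proof (rule abelian_groupI)
    fix p assume "p \<in> carrier (idealization R M)"
    then obtain a x where p: "p = (a, x)" and ax: "a \<in> carrier R" "x \<in> carrier M"
      by (auto simp: idealization_def)
    have "(\<ominus> a, \<ominus>\<^bsub>M\<^esub> x) \<in> carrier (idealization R M)"
      "(\<ominus> a, \<ominus>\<^bsub>M\<^esub> x) \<oplus>\<^bsub>idealization R M\<^esub> p = \<zero>\<^bsub>idealization R M\<^esub>"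
      using ax by (auto simp: idealization_def p R.l_neg M.l_neg)
    then show "\<exists>q \<in> carrier (idealization R M).
        q \<oplus>\<^bsub>idealization R M\<^esub> p = \<zero>\<^bsub>idealization R M\<^esub>" by blast
  qed (auto simp: idealization_def R.a_ac M.a_ac)
  show "comm_monoid (idealization R M)"
    by (rule comm_monoidI)
      (auto simp: idealization_def R.m_ac M.a_ac smult_r_distr
        smult_assoc1[symmetric] smult_r_null)
next
  fix p q r
  assume "p \<in> carrier (idealization R M)" "q \<in> carrier (idealization R M)"
    "r \<in> carrier (idealization R M)"
  then show "(p \<oplus>\<^bsub>idealization R M\<^esub> q) \<otimes>\<^bsub>idealization R M\<^esub> r =
      p \<otimes>\<^bsub>idealization R M\<^esub> r \<oplus>\<^bsub>idealization R M\<^esub> q \<otimes>\<^bsub>idealization R M\<^esub> r"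
    by (auto simp: idealization_def R.l_distr smult_l_distr smult_r_distr M.a_ac)
qed

end

theory Submission
  imports Defs "HOL-Algebra.QuotRing"
begin

text \<open>
  Write \<open>R = A(+)M\<close> and \<open>N = 0(+)M\<close>. Everything rests on two observations. An element \<open>(s, x)\<close> of
  \<open>R\<close> is regular exactly when \<open>s \<in> S\<close> (\<open>regular_elements_idealization\<close>), and \<open>N\<close>, being an ideal of
  square zero, lies in every radical ideal of \<open>R\<close>. An ideal of \<open>R\<close> that contains \<open>N\<close> has the form
  \<open>I \<times> M\<close>, so it is determined by its image \<open>I\<close> under the projection \<open>R \<rightarrow> A\<close>; that
  projection respects products of ideals and matches radical ideals of \<open>R\<close> with radical ideals
  of \<open>A\<close>.

  Suppose that \<open>R\<close> is an SP-ring. If an ideal \<open>I\<close> of \<open>A\<close> meets \<open>S\<close>, then \<open>I \<times> M\<close> is regular, and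
  projecting a factorization of it to \<open>A\<close> factors \<open>I\<close>. For divisibility, take \<open>s \<in> S\<close> and
  put \<open>t = (s, 0)\<close>. The regular ideal \<open>tR\<close> is a product \<open>K\<^sub>1 \<cdots> K\<^sub>n\<close> of radical ideals, each
  containing \<open>N\<close>. As a factor of a principal ideal with regular generator, each \<open>K\<^sub>i\<close> is invertible,
  and this together with \<open>N \<inter> tR = tN\<close> forces \<open>N = K\<^sub>i N\<close>. Multiplying by all the factors
  in turn gives \<open>N = K\<^sub>1 \<cdots> K\<^sub>n N = tN\<close>, which says \<open>M = sM\<close>
  (\<open>regular_principal_product_divides\<close>).

  Conversely, let \<open>sM = M\<close> for all \<open>s \<in> S\<close>. A regular ideal of \<open>R\<close> contains some \<open>(s, x)\<close> with
  \<open>s \<in> S\<close>, hence all products \<open>(s, x)(0, z) = (0, sz)\<close>, hence \<open>N\<close>. So a regular ideal \<open>K\<close> equals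
  \<open>I \<times> M\<close> with \<open>I\<close> meeting \<open>S\<close>. Factor \<open>I = J\<^sub>1 \<cdots> J\<^sub>n\<close> into radical ideals. The product of the ideals
  \<open>J\<^sub>i \<times> M\<close> is again regular, so it contains \<open>N\<close> as well; since it has the same image in \<open>A\<close> as
  \<open>K\<close>, it equals \<open>K\<close>.
\<close>

section \<open>Products of ideals and regular elements\<close>

context cring
begin

lemma ideal_foldr_prod:
  "(\<And>J. J \<in> set Js \<Longrightarrow> ideal J R) \<Longrightarrow> ideal (foldr (ideal_prod R) Js (carrier R)) R"
  by (induction Js) (auto intro: oneideal ideal_prod_is_ideal)

lemma foldr_prod_factor:
  assumes "\<And>J. J \<in> set Js \<Longrightarrow> ideal J R" and "K \<in> set Js"
  shows "\<exists>L. ideal L R \<and> foldr (ideal_prod R) Js (carrier R) = K \<cdot> L"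
  using assms
proof (induction Js)
  case (Cons J Js)
  let ?F = "foldr (ideal_prod R) Js (carrier R)"
  have F: "ideal ?F R" using Cons.prems(1) by (intro ideal_foldr_prod) auto
  show ?case
  proof (cases "K = J")
    case True
    then show ?thesis using F by auto
  next
    case False
    then obtain L where L: "ideal L R" "?F = K \<cdot> L" using Cons by auto
    have J: "ideal J R" and K: "ideal K R" using Cons.prems by auto
    have "J \<cdot> (K \<cdot> L) = K \<cdot> (J \<cdot> L)"
      using J K L(1) by (metis ideal_prod_assoc ideal_prod_commute)
    then show ?thesis using ideal_prod_is_ideal[OF J L(1)] L(2) by (intro exI[of _ "J \<cdot> L"]) simp
  qed
qed simp

lemma subset_prod_foldr:
  assumes "\<And>J. J \<in> set Js \<Longrightarrow> ideal J R" and N: "ideal N R"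
    and "\<And>J. J \<in> set Js \<Longrightarrow> N \<subseteq> J \<cdot> N"
  shows "N \<subseteq> foldr (ideal_prod R) Js (carrier R) \<cdot> N"
  using assms(1,3)
proof (induction Js)
  case Nil
  then show ?case using ideal_prod_one[OF N] ideal_prod_commute[OF N oneideal] by simp
next
  case (Cons J Js)
  let ?F = "foldr (ideal_prod R) Js (carrier R)"
  have F: "ideal ?F R" using Cons.prems(1) by (intro ideal_foldr_prod) auto
  have J: "ideal J R" and NJ: "N \<subseteq> J \<cdot> N" and NF: "N \<subseteq> ?F \<cdot> N" using Cons by auto
  have "J \<cdot> N \<subseteq> J \<cdot> (?F \<cdot> N)"
  proof
    fix x assume "x \<in> J \<cdot> N"
    then show "x \<in> J \<cdot> (?F \<cdot> N)"
      using NF by induction (auto intro: ideal_prod.intros)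
  qed
  then show ?case using NJ ideal_prod_assoc[OF J F N] by auto
qed

lemma subset_ideal_radical:
  assumes "ideal I R" shows "I \<subseteq> ideal_radical R I"
proof
  fix x assume "x \<in> I"
  then show "x \<in> ideal_radical R I"
    using ideal.Icarr[OF assms] by (auto simp: ideal_radical_def intro!: exI[of _ "1::nat"])
qed

lemma regular_element_cancel:
  assumes "t \<in> regular_elements R" "x \<in> carrier R" "y \<in> carrier R" "t \<otimes> x = t \<otimes> y"
  shows "x = y"
proof -
  have t: "t \<in> carrier R" using assms(1) by (simp add: regular_elements_def)
  have "t \<otimes> (x \<ominus> y) = \<zero>"
    using assms t by (simp add: a_minus_def r_distr r_minus r_neg)
  then have "x \<ominus> y = \<zero>"
    using assms t by (auto simp: regular_elements_def zerodivisors_def)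
  then show ?thesis using assms(2,3) minus_equality[of x "\<ominus> y"] by (simp add: minus_eq)
qed

lemma regular_elements_mult:
  assumes "s \<in> regular_elements R" "t \<in> regular_elements R"
  shows "s \<otimes> t \<in> regular_elements R"
proof -
  have st: "s \<in> carrier R" "t \<in> carrier R" using assms by (auto simp: regular_elements_def)
  have "b = \<zero>" if "b \<in> carrier R" "s \<otimes> t \<otimes> b = \<zero>" for b
  proof -
    have "t \<otimes> b = \<zero>"
      using that st regular_element_cancel[OF assms(1), of "t \<otimes> b" \<zero>] by (simp add: m_assoc)
    then show ?thesis
      using that st regular_element_cancel[OF assms(2), of b \<zero>] by simp
  qed
  then show ?thesis using st by (auto simp: regular_elements_def zerodivisors_def)
qed

lemma regular_ideal_foldr_prod:
  assumes "\<And>J. J \<in> set Js \<Longrightarrow> regular_ideal J R"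
  shows "regular_ideal (foldr (ideal_prod R) Js (carrier R)) R"
  using assms
proof (induction Js)
  case Nil
  have "\<one> \<in> regular_elements R" by (auto simp: regular_elements_def zerodivisors_def)
  then show ?case using oneideal by (auto simp: regular_ideal_def)
next
  case (Cons J Js)
  let ?F = "foldr (ideal_prod R) Js (carrier R)"
  have J: "regular_ideal J R" and F: "regular_ideal ?F R" using Cons by auto
  then obtain s t where "s \<in> J" "s \<in> regular_elements R" "t \<in> ?F" "t \<in> regular_elements R"
    by (auto simp: regular_ideal_def)
  then have "s \<otimes> t \<in> J \<cdot> ?F" "s \<otimes> t \<in> regular_elements R"
    by (auto intro: ideal_prod.prod regular_elements_mult)
  then show ?case using J F by (auto simp: regular_ideal_def intro: ideal_prod_is_ideal)
qed

text \<open>A factor \<open>J\<close> of the regular principal ideal \<open>tR = JL\<close> is invertible with inverse \<open>t\<^sup>-\<^sup>1 L\<close>. The ideal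
  \<open>LN\<close> lies in \<open>N\<close> and in \<open>LJ = tR\<close>, hence in \<open>N \<inter> tR = tN\<close>; so \<open>t\<^sup>-\<^sup>1 LN \<subseteq> N\<close>, and
  \<open>N = J(t\<^sup>-\<^sup>1 LN) \<subseteq> JN\<close>. The proof avoids fractions by showing \<open>tn \<in> t(JN)\<close> and cancelling \<open>t\<close>.\<close>

lemma regular_principal_factor_absorbs:
  assumes t: "t \<in> regular_elements R" and J: "ideal J R" and L: "ideal L R"
    and tJL: "PIdl t = J \<cdot> L"
    and N: "ideal N R" and NJ: "N \<subseteq> J"
    and tN: "\<And>b. b \<in> carrier R \<Longrightarrow> t \<otimes> b \<in> N \<Longrightarrow> b \<in> N"
  shows "N \<subseteq> J \<cdot> N"
proof
  fix n assume n: "n \<in> N"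
  have tc: "t \<in> carrier R" using t by (simp add: regular_elements_def)
  have nc: "n \<in> carrier R" using n N by (simp add: ideal.Icarr)
  have JN: "ideal (J \<cdot> N) R" using J N by (rule ideal_prod_is_ideal)
  have "x \<otimes> n \<in> (\<otimes>) t ` (J \<cdot> N)" if "x \<in> J \<cdot> L" for x
    using that
  proof induction
    case (prod j l)
    have jc: "j \<in> carrier R" and lc: "l \<in> carrier R" using prod J L by (auto simp: ideal.Icarr)
    \<comment> \<open>Here \<open>n\<close> is used as an element of \<open>J\<close>, so that \<open>n \<otimes> l\<close> is a multiple of \<open>t\<close>.\<close>
    have "n \<otimes> l \<in> PIdl t" unfolding tJL using n NJ prod(2) by (auto intro: ideal_prod.prod)
    then obtain b where b: "b \<in> carrier R" "n \<otimes> l = b \<otimes> t" by (auto simp: cgenideal_def)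
    have "t \<otimes> b \<in> N"
      using ideal.I_r_closed[OF N n lc] b tc by (simp add: m_comm)
    then have "b \<in> N" by (rule tN[OF b(1)])
    moreover have "j \<otimes> l \<otimes> n = t \<otimes> (j \<otimes> b)"
    proof -
      have "j \<otimes> l \<otimes> n = j \<otimes> (n \<otimes> l)" using jc lc nc by (simp add: m_ac)
      then show ?thesis using b jc tc by (simp add: m_lcomm m_comm[of b])
    qed
    ultimately show ?case using prod(1) by (auto intro: ideal_prod.prod)
  next
    case (sum x y)
    obtain u v where uv: "u \<in> J \<cdot> N" "v \<in> J \<cdot> N" "x \<otimes> n = t \<otimes> u" "y \<otimes> n = t \<otimes> v"
      using sum by auto
    have c: "x \<in> carrier R" "y \<in> carrier R" "u \<in> carrier R" "v \<in> carrier R"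
      using sum.hyps uv ideal_prod_in_carrier[OF J L] ideal_prod_in_carrier[OF J N] by auto
    have "(x \<oplus> y) \<otimes> n = t \<otimes> (u \<oplus> v)" using c uv nc tc by (simp add: l_distr r_distr)
    then show ?case using uv by (auto intro: ideal_prod.sum)
  qed
  then have "t \<otimes> n \<in> (\<otimes>) t ` (J \<cdot> N)" using cgenideal_self[OF tc] tJL by simp
  then obtain y where "y \<in> J \<cdot> N" "t \<otimes> n = t \<otimes> y" by auto
  then show "n \<in> J \<cdot> N" using regular_element_cancel[OF t nc] JN by (metis ideal.Icarr)
qed

text \<open>Every factor absorbs \<open>N\<close>, in the sense \<open>N \<subseteq> JN\<close>, so the whole product does, and that product
  is \<open>tR\<close>. Applied to \<open>N = 0(+)M\<close> this is the source of divisibility of \<open>M\<close>.\<close>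

lemma regular_principal_product_divides:
  assumes t: "t \<in> regular_elements R"
    and Js: "\<And>J. J \<in> set Js \<Longrightarrow> ideal J R" "\<And>J. J \<in> set Js \<Longrightarrow> N \<subseteq> J"
    and eq: "PIdl t = foldr (ideal_prod R) Js (carrier R)"
    and N: "ideal N R"
    and tN: "\<And>b. b \<in> carrier R \<Longrightarrow> t \<otimes> b \<in> N \<Longrightarrow> b \<in> N"
  shows "N \<subseteq> (\<otimes>) t ` N"
proof -
  have tc: "t \<in> carrier R" using t by (simp add: regular_elements_def)
  have "N \<subseteq> J \<cdot> N" if "J \<in> set Js" for J
    using foldr_prod_factor[of Js J] that Js eq N t tN regular_principal_factor_absorbs by metis
  then have "N \<subseteq> (PIdl t) \<cdot> N" unfolding eq using Js(1) N by (intro subset_prod_foldr)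
  moreover have "x \<in> (\<otimes>) t ` N" if "x \<in> (PIdl t) \<cdot> N" for x
    using that
  proof induction
    case (prod i n)
    then obtain r where r: "r \<in> carrier R" "i = r \<otimes> t" by (auto simp: cgenideal_def)
    have "i \<otimes> n = t \<otimes> (r \<otimes> n)" using r prod tc ideal.Icarr[OF N] by (simp add: m_ac)
    then show ?case using ideal.I_l_closed[OF N prod(2) r(1)] by auto
  next
    case (sum x y)
    then obtain u v where uv: "u \<in> N" "v \<in> N" "x = t \<otimes> u" "y = t \<otimes> v" by auto
    then have "x \<oplus> y = t \<otimes> (u \<oplus> v)" using tc ideal.Icarr[OF N] by (simp add: r_distr)
    moreover have "u \<oplus> v \<in> N"
      using uv additive_subgroup.a_closed[OF ideal.axioms(1)[OF N]] by simp
    ultimately show ?case by auto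
  qed
  ultimately show ?thesis by blast
qed

end

section \<open>Ideals of an idealization\<close>

context module
begin

abbreviation Idn where "Idn \<equiv> idealization R M"

sublocale Idn: cring "idealization R M"
  by (rule cring_idealization)

lemma idealization_simps:
  "carrier Idn = carrier R \<times> carrier M"
  "\<zero>\<^bsub>Idn\<^esub> = (\<zero>, \<zero>\<^bsub>M\<^esub>)"
  "(a, x) \<oplus>\<^bsub>Idn\<^esub> (b, y) = (a \<oplus> b, x \<oplus>\<^bsub>M\<^esub> y)"
  "(a, x) \<otimes>\<^bsub>Idn\<^esub> (b, y) = (a \<otimes> b, (a \<odot>\<^bsub>M\<^esub> y) \<oplus>\<^bsub>M\<^esub> (b \<odot>\<^bsub>M\<^esub> x))"
  by (simp_all add: idealization_def)

lemma fst_ring_hom: "fst \<in> ring_hom Idn R"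
  by (rule ring_hom_memI) (auto simp: idealization_def)

sublocale proj: ring_hom_cring "idealization R M" R fst
  by (rule ring_hom_cringI[OF ring_hom_ringI2[OF Idn.ring_axioms R.ring_axioms fst_ring_hom]
    Idn.is_cring R.is_cring])

lemma fst_nat_pow:
  "p \<in> carrier Idn \<Longrightarrow> fst (p [^]\<^bsub>Idn\<^esub> (n::nat)) = fst p [^] n"
  by (induction n) auto

text \<open>If \<open>(a, x)\<close> is regular, then multiplying by elements \<open>(0, y)\<close> shows that \<open>a\<close> is regular on \<open>M\<close>.
  Regularity of \<open>a\<close> on the ring then follows: if \<open>ab = 0\<close>, then \<open>a\<close> annihilates \<open>bx\<close>, so \<open>bx = 0\<close> and
  \<open>(a, x)(b, 0) = 0\<close>.\<close>

lemma regular_elements_idealization: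
  "regular_elements Idn =
    (carrier R - (zerodivisors R \<union> module_zerodivisors R M)) \<times> carrier M"
proof (intro equalityI subsetI)
  fix p assume p: "p \<in> regular_elements Idn"
  then obtain a x where ax: "p = (a, x)" "a \<in> carrier R" "x \<in> carrier M"
    by (auto simp: regular_elements_def idealization_simps)
  have reg: "q = (\<zero>, \<zero>\<^bsub>M\<^esub>)"
    if "q \<in> carrier Idn" "(a, x) \<otimes>\<^bsub>Idn\<^esub> q = (\<zero>, \<zero>\<^bsub>M\<^esub>)" for q
    using p that ax by (auto simp: regular_elements_def zerodivisors_def idealization_simps(1,2))
  have M_reg: "y = \<zero>\<^bsub>M\<^esub>" if "y \<in> carrier M" "a \<odot>\<^bsub>M\<^esub> y = \<zero>\<^bsub>M\<^esub>" for y
    using reg[of "(\<zero>, y)"] that ax by (simp add: idealization_simps)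
  have "b = \<zero>" if b: "b \<in> carrier R" "a \<otimes> b = \<zero>" for b
  proof -
    have "a \<odot>\<^bsub>M\<^esub> (b \<odot>\<^bsub>M\<^esub> x) = \<zero>\<^bsub>M\<^esub>"
      using b ax by (simp flip: smult_assoc1)
    then have "b \<odot>\<^bsub>M\<^esub> x = \<zero>\<^bsub>M\<^esub>" using M_reg[of "b \<odot>\<^bsub>M\<^esub> x"] b ax by simp
    then show ?thesis using reg[of "(b, \<zero>\<^bsub>M\<^esub>)"] b ax by (simp add: idealization_simps)
  qed
  with M_reg show
    "p \<in> (carrier R - (zerodivisors R \<union> module_zerodivisors R M)) \<times> carrier M"
    using ax by (auto simp: zerodivisors_def module_zerodivisors_def)
next
  fix p assume "p \<in> (carrier R - (zerodivisors R \<union> module_zerodivisors R M)) \<times> carrier M"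
  then obtain s x where sx: "p = (s, x)" "s \<in> carrier R" "x \<in> carrier M"
    and s: "s \<notin> zerodivisors R" "s \<notin> module_zerodivisors R M"
    by auto
  have R_reg: "b = \<zero>" if "b \<in> carrier R" "s \<otimes> b = \<zero>" for b
    using that s sx by (auto simp: zerodivisors_def)
  have M_reg: "y = \<zero>\<^bsub>M\<^esub>" if "y \<in> carrier M" "s \<odot>\<^bsub>M\<^esub> y = \<zero>\<^bsub>M\<^esub>" for y
    using that s sx by (auto simp: module_zerodivisors_def)
  have "b = \<zero> \<and> y = \<zero>\<^bsub>M\<^esub>"
    if "b \<in> carrier R" "y \<in> carrier M" "(s, x) \<otimes>\<^bsub>Idn\<^esub> (b, y) = (\<zero>, \<zero>\<^bsub>M\<^esub>)" for b y
  proof -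
    have "b = \<zero>" using that R_reg[of b] by (simp add: idealization_simps)
    then show ?thesis using that M_reg[of y] sx by (simp add: idealization_simps)
  qed
  then show "p \<in> regular_elements Idn"
    using sx by (auto simp: regular_elements_def zerodivisors_def idealization_simps(1,2))
qed

lemma ideal_times_carrier:
  assumes "ideal I R" shows "ideal (I \<times> carrier M) Idn"
proof -
  have "I \<times> carrier M = {p \<in> carrier Idn. fst p \<in> I}"
    using ideal.Icarr[OF assms] by (auto simp: idealization_simps)
  then show ?thesis using proj.ring.ideal_vimage[OF assms] by simp
qed

lemma ideal_fst_image:
  assumes K: "ideal K Idn" shows "ideal (fst ` K) R"
proof -
  interpret K: ideal K Idn by (rule K)
  show ?thesis
  proof (rule idealI[OF R.ring_axioms])
    show "subgroup (fst ` K) (add_monoid R)"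
    proof (rule R.add.subgroupI)
      show "fst ` K \<subseteq> carrier R" using K.Icarr proj.hom_closed by auto
      show "fst ` K \<noteq> {}" using K.zero_closed by blast
    next
      fix a assume "a \<in> fst ` K"
      then obtain p where p: "p \<in> K" "a = fst p" by auto
      have "\<ominus> a = fst (\<ominus>\<^bsub>Idn\<^esub> p)" using p K.Icarr by simp
      then show "\<ominus> a \<in> fst ` K" using p K.a_inv_closed by (intro image_eqI)
    next
      fix a b assume "a \<in> fst ` K" "b \<in> fst ` K"
      then obtain p q where p: "p \<in> K" "a = fst p" "q \<in> K" "b = fst q" by auto
      have "a \<oplus> b = fst (p \<oplus>\<^bsub>Idn\<^esub> q)" using p K.Icarr by simp
      then show "a \<oplus> b \<in> fst ` K" using p K.a_closed by (intro image_eqI)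
    qed
  next
    fix a r assume "a \<in> fst ` K" and r: "r \<in> carrier R"
    then obtain p where p: "p \<in> K" "a = fst p" by auto
    have r': "(r, \<zero>\<^bsub>M\<^esub>) \<in> carrier Idn" using r by (simp add: idealization_simps)
    have "r \<otimes> a = fst ((r, \<zero>\<^bsub>M\<^esub>) \<otimes>\<^bsub>Idn\<^esub> p)" using p r' K.Icarr by simp
    then show "r \<otimes> a \<in> fst ` K" using K.I_l_closed[OF p(1) r'] by (intro image_eqI)
    then show "a \<otimes> r \<in> fst ` K" using p r K.Icarr by (simp add: R.m_comm)
  qed
qed

lemma fst_image_ideal_prod:
  assumes K: "ideal K Idn" and L: "ideal L Idn"
  shows "fst ` (ideal_prod Idn K L) = ideal_prod R (fst ` K) (fst ` L)"
proof (intro equalityI subsetI)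
  fix a assume "a \<in> fst ` (ideal_prod Idn K L)"
  then obtain p where "p \<in> ideal_prod Idn K L" and a: "a = fst p" by auto
  from this(1) have "fst p \<in> ideal_prod R (fst ` K) (fst ` L)"
  proof induction
    case (prod p q)
    then show ?case using K L by (auto simp: ideal.Icarr intro!: ideal_prod.prod)
  next
    case (sum p q)
    then have "fst (p \<oplus>\<^bsub>Idn\<^esub> q) = fst p \<oplus> fst q"
      using Idn.ideal_prod_in_carrier[OF K L] by (intro proj.hom_add) auto
    with sum show ?case by (simp add: ideal_prod.sum)
  qed
  then show "a \<in> ideal_prod R (fst ` K) (fst ` L)" by (simp add: a)
next
  fix a assume "a \<in> ideal_prod R (fst ` K) (fst ` L)"
  then show "a \<in> fst ` (ideal_prod Idn K L)"
  proof induction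
    case (prod a b)
    then obtain p q where p: "p \<in> K" "a = fst p" "q \<in> L" "b = fst q" by auto
    then have "a \<otimes> b = fst (p \<otimes>\<^bsub>Idn\<^esub> q)" using K L by (simp add: ideal.Icarr)
    then show ?case using p by (intro image_eqI) (auto intro: ideal_prod.prod)
  next
    case (sum a b)
    then obtain p q where p: "p \<in> ideal_prod Idn K L" "a = fst p"
      "q \<in> ideal_prod Idn K L" "b = fst q" by auto
    then have "p \<in> carrier Idn" "q \<in> carrier Idn"
      using Idn.ideal_prod_in_carrier[OF K L] by auto
    then have "a \<oplus> b = fst (p \<oplus>\<^bsub>Idn\<^esub> q)" using p by (simp only: proj.hom_add)
    then show ?case using p by (intro image_eqI[of _ _ "p \<oplus>\<^bsub>Idn\<^esub> q"] ideal_prod.sum) simp_all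
  qed
qed

lemma fst_image_foldr_prod:
  assumes "\<And>K. K \<in> set Ks \<Longrightarrow> ideal K Idn"
  shows "fst ` (foldr (ideal_prod Idn) Ks (carrier Idn)) =
    foldr (ideal_prod R) (map ((`) fst) Ks) (carrier R)"
  using assms
proof (induction Ks)
  case Nil
  then show ?case using M.zero_closed by (force simp: idealization_simps(1) simp del: M.zero_closed)
next
  case (Cons K Ks)
  then show ?case using Idn.ideal_foldr_prod[of Ks] by (simp add: fst_image_ideal_prod)
qed

text \<open>The second coordinate of an element can be changed at will by adding an element of \<open>0(+)M\<close>.
  Thus the ideals above \<open>0(+)M\<close> can be compared through their images in the base ring.\<close>

lemma ideal_containing_module_eq_times:
  assumes K: "ideal K Idn" and MK: "{\<zero>} \<times> carrier M \<subseteq> K"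
  shows "K = fst ` K \<times> carrier M"
proof (intro equalityI subsetI)
  fix p assume "p \<in> K"
  then show "p \<in> fst ` K \<times> carrier M"
    using ideal.Icarr[OF K] by (cases p) (force simp: idealization_simps(1))
next
  fix p assume "p \<in> fst ` K \<times> carrier M"
  then obtain a x y where p: "p = (a, x)" "(a, y) \<in> K" and x: "x \<in> carrier M" by auto
  have ay: "a \<in> carrier R" "y \<in> carrier M"
    using ideal.Icarr[OF K p(2)] by (auto simp: idealization_simps(1))
  have "(\<zero>, x \<ominus>\<^bsub>M\<^esub> y) \<in> K" using MK x ay by auto
  then have "(a, y) \<oplus>\<^bsub>Idn\<^esub> (\<zero>, x \<ominus>\<^bsub>M\<^esub> y) \<in> K"
    using p(2) K by (simp add: additive_subgroup.a_closed ideal.axioms(1))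
  moreover have "y \<oplus>\<^bsub>M\<^esub> (x \<ominus>\<^bsub>M\<^esub> y) = x"
    using x ay by (simp add: M.minus_eq M.a_lcomm M.r_neg)
  ultimately show "p \<in> K" using p ay by (simp add: idealization_simps)
qed

text \<open>The elements \<open>(0, x)\<close> have square zero.\<close>

lemma radical_ideal_contains_module:
  assumes "radical_ideal K Idn"
  shows "{\<zero>} \<times> carrier M \<subseteq> K"
proof
  fix p assume "p \<in> {\<zero>} \<times> carrier M"
  then obtain x where p: "p = (\<zero>, x)" "x \<in> carrier M" by auto
  have K: "ideal K Idn" using assms by (simp add: radical_ideal_def)
  have pc: "p \<in> carrier Idn" using p by (simp add: idealization_simps)
  have "p [^]\<^bsub>Idn\<^esub> (2::nat) = \<zero>\<^bsub>Idn\<^esub>"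
    using p pc by (simp add: numeral_2_eq_2 idealization_simps)
  then have "p [^]\<^bsub>Idn\<^esub> (2::nat) \<in> K"
    using additive_subgroup.zero_closed[OF ideal.axioms(1)[OF K]] by simp
  then have "p \<in> ideal_radical Idn K" 
    unfolding ideal_radical_def using pc by (auto intro!: exI[of _ "2::nat"])
  then show "p \<in> K" using assms by (simp add: radical_ideal_def)
qed

lemma radical_ideal_times_carrier:
  assumes "radical_ideal J R" shows "radical_ideal (J \<times> carrier M) Idn"
proof -
  have J: "ideal J R" "ideal_radical R J = J" using assms by (auto simp: radical_ideal_def)
  have I: "ideal (J \<times> carrier M) Idn" using ideal_times_carrier J by simp
  have "ideal_radical Idn (J \<times> carrier M) \<subseteq> J \<times> carrier M"
  proof
    fix p assume "p \<in> ideal_radical Idn (J \<times> carrier M)"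
    then obtain n :: nat where p: "p \<in> carrier Idn" "n > 0" "fst (p [^]\<^bsub>Idn\<^esub> n) \<in> J"
      by (auto simp: ideal_radical_def)
    then have "fst p [^] n \<in> J" by (simp only: fst_nat_pow)
    then have "fst p \<in> ideal_radical R J"
      using p proj.hom_closed unfolding ideal_radical_def by blast
    then have "fst p \<in> J" by (simp only: J(2))
    then show "p \<in> J \<times> carrier M"
      using p(1) by (simp add: idealization_simps(1) mem_Times_iff)
  qed
  then show ?thesis
    using I Idn.subset_ideal_radical[OF I] by (auto simp: radical_ideal_def)
qed

lemma radical_ideal_fst_image:
  assumes "radical_ideal K Idn" shows "radical_ideal (fst ` K) R"
proof -
  have K: "ideal K Idn" "ideal_radical Idn K = K" using assms by (auto simp: radical_ideal_def)
  have I: "ideal (fst ` K) R" using ideal_fst_image K by simp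
  have Keq: "K = fst ` K \<times> carrier M"
    using ideal_containing_module_eq_times[OF K(1) radical_ideal_contains_module[OF assms]] .
  have "ideal_radical R (fst ` K) \<subseteq> fst ` K"
  proof
    fix a assume "a \<in> ideal_radical R (fst ` K)"
    then obtain n :: nat where a: "a \<in> carrier R" "n > 0" "a [^] n \<in> fst ` K"
      by (auto simp: ideal_radical_def)
    have ac: "(a, \<zero>\<^bsub>M\<^esub>) \<in> carrier Idn" using a by (simp add: idealization_simps)
    have "(a, \<zero>\<^bsub>M\<^esub>) [^]\<^bsub>Idn\<^esub> n \<in> fst ` K \<times> carrier M"
      using a(3) fst_nat_pow[OF ac, of n] Idn.nat_pow_closed[OF ac, of n]
      by (cases "(a, \<zero>\<^bsub>M\<^esub>) [^]\<^bsub>Idn\<^esub> n") (auto simp: idealization_simps(1))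
    then have "(a, \<zero>\<^bsub>M\<^esub>) \<in> ideal_radical Idn K"
      using ac a(2) Keq by (auto simp: ideal_radical_def)
    then show "a \<in> fst ` K" using K(2) by force
  qed
  then show ?thesis
    using I R.subset_ideal_radical[OF I] by (auto simp: radical_ideal_def)
qed

text \<open>A regular element \<open>(s, x)\<close> of the ideal yields \<open>(s, x)(0, z) = (0, sz)\<close>, and by divisibility
  every element of \<open>0(+)M\<close> has this form.\<close>

lemma divisible_regular_ideal_contains_module:
  assumes K: "regular_ideal K Idn"
    and div: "\<And>s. s \<in> carrier R - (zerodivisors R \<union> module_zerodivisors R M) \<Longrightarrow>
      (\<lambda>x. s \<odot>\<^bsub>M\<^esub> x) ` carrier M = carrier M"
  shows "{\<zero>} \<times> carrier M \<subseteq> K"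
proof
  fix p assume "p \<in> {\<zero>} \<times> carrier M"
  then obtain y where p: "p = (\<zero>, y)" "y \<in> carrier M" by auto
  have I: "ideal K Idn" using K by (simp add: regular_ideal_def)
  obtain s x where sx: "(s, x) \<in> K" "x \<in> carrier M"
    "s \<in> carrier R - (zerodivisors R \<union> module_zerodivisors R M)"
    using K by (auto simp: regular_ideal_def regular_elements_idealization)
  obtain z where z: "z \<in> carrier M" "y = s \<odot>\<^bsub>M\<^esub> z" using div[OF sx(3)] p(2) by blast
  have "p = (s, x) \<otimes>\<^bsub>Idn\<^esub> (\<zero>, z)" using p z sx by (simp add: idealization_simps)
  then show "p \<in> K"
    using ideal.I_r_closed[OF I sx(1), of "(\<zero>, z)"] z by (simp add: idealization_simps)
qed

end

section \<open>Transfer of factorizations and divisibility\<close>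

context module
begin

text \<open>Factor \<open>I \<times> M\<close> in the idealization and project the factors.\<close>

lemma SP_idealization_imp_product:
  assumes SP: "SP_ring Idn" and I: "ideal I R"
    and s: "s \<in> I" "s \<in> carrier R - (zerodivisors R \<union> module_zerodivisors R M)"
  shows "product_of_radical_ideals I R"
proof -
  have "(s, \<zero>\<^bsub>M\<^esub>) \<in> (I \<times> carrier M) \<inter> regular_elements Idn"
    using s by (simp add: regular_elements_idealization)
  then have "regular_ideal (I \<times> carrier M) Idn"
    using ideal_times_carrier[OF I] unfolding regular_ideal_def by blast
  then obtain Ks where Ks: "\<And>K. K \<in> set Ks \<Longrightarrow> radical_ideal K Idn"
    "I \<times> carrier M = foldr (ideal_prod Idn) Ks (carrier Idn)"
    using SP_ring.regular_ideal_product[OF SP] unfolding product_of_radical_ideals_def by blast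
  have "fst ` (I \<times> carrier M) = foldr (ideal_prod R) (map ((`) fst) Ks) (carrier R)"
    unfolding Ks(2) using Ks(1) by (intro fst_image_foldr_prod) (simp add: radical_ideal_def)
  moreover have "fst ` (I \<times> carrier M) = I" using M.zero_closed by force
  ultimately show ?thesis
    unfolding product_of_radical_ideals_def
    using radical_ideal_fst_image[OF Ks(1)] by (intro exI[of _ "map ((`) fst) Ks"]) auto
qed

text \<open>The regular element \<open>(s, 0)\<close> generates a product of radical ideals, each containing
  \<open>0(+)M\<close>, so \<open>(s, 0)\<close> divides every element of \<open>0(+)M\<close> within \<open>0(+)M\<close>.\<close>

lemma SP_idealization_imp_divisible:
  assumes SP: "SP_ring Idn"
    and s: "s \<in> carrier R - (zerodivisors R \<union> module_zerodivisors R M)"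
  shows "(\<lambda>x. s \<odot>\<^bsub>M\<^esub> x) ` carrier M = carrier M"
proof
  have sc: "s \<in> carrier R" using s by simp
  then show "(\<lambda>x. s \<odot>\<^bsub>M\<^esub> x) ` carrier M \<subseteq> carrier M" by auto
  define t where "t = (s, \<zero>\<^bsub>M\<^esub>)"
  have t: "t \<in> regular_elements Idn" and tc: "t \<in> carrier Idn"
    using s by (auto simp: t_def regular_elements_idealization idealization_simps)
  have "regular_ideal (PIdl\<^bsub>Idn\<^esub> t) Idn"
    using t Idn.cgenideal_ideal[OF tc] Idn.cgenideal_self[OF tc] by (auto simp: regular_ideal_def)
  then obtain Ks where Ks: "\<And>K. K \<in> set Ks \<Longrightarrow> radical_ideal K Idn"
    "PIdl\<^bsub>Idn\<^esub> t = foldr (ideal_prod Idn) Ks (carrier Idn)"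
    using SP_ring.regular_ideal_product[OF SP] unfolding product_of_radical_ideals_def by blast
  have "{\<zero>} \<times> carrier M \<subseteq> (\<lambda>q. t \<otimes>\<^bsub>Idn\<^esub> q) ` ({\<zero>} \<times> carrier M)"
  proof (rule Idn.regular_principal_product_divides[OF t _ _ Ks(2)])
    show "ideal ({\<zero>} \<times> carrier M) Idn" using ideal_times_carrier[OF R.zeroideal] .
    fix q assume "q \<in> carrier Idn" "t \<otimes>\<^bsub>Idn\<^esub> q \<in> {\<zero>} \<times> carrier M"
    then show "q \<in> {\<zero>} \<times> carrier M"
      using s by (auto simp: t_def idealization_simps zerodivisors_def)
  next
    fix K assume "K \<in> set Ks"
    then have "radical_ideal K Idn" by (rule Ks(1))
    then show "ideal K Idn" "{\<zero>} \<times> carrier M \<subseteq> K"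
      using radical_ideal_contains_module by (auto simp: radical_ideal_def)
  qed
  then show "carrier M \<subseteq> (\<lambda>x. s \<odot>\<^bsub>M\<^esub> x) ` carrier M"
    using sc by (force simp: t_def idealization_simps)
qed

text \<open>The candidate factors of \<open>K\<close> are the \<open>J \<times> M\<close>, with \<open>J\<close> running through the factors of the
  image of \<open>K\<close>. Rather than computing the module part of their product, it suffices to know that
  the product is regular, since divisibility then puts \<open>0(+)M\<close> inside it.\<close>

lemma divisible_imp_SP_idealization:
  assumes prod: "\<And>I. ideal I R \<Longrightarrow>
      I \<inter> (carrier R - (zerodivisors R \<union> module_zerodivisors R M)) \<noteq> {} \<Longrightarrow>
      product_of_radical_ideals I R"
    and div: "\<And>s. s \<in> carrier R - (zerodivisors R \<union> module_zerodivisors R M) \<Longrightarrow>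
      (\<lambda>x. s \<odot>\<^bsub>M\<^esub> x) ` carrier M = carrier M"
  shows "SP_ring Idn"
proof unfold_locales
  fix K assume K: "regular_ideal K Idn"
  have KI: "ideal K Idn" using K by (simp add: regular_ideal_def)
  have Keq: "K = fst ` K \<times> carrier M"
    using ideal_containing_module_eq_times[OF KI divisible_regular_ideal_contains_module[OF K div]] .
  obtain s x where s: "(s, x) \<in> K"
    "s \<in> carrier R - (zerodivisors R \<union> module_zerodivisors R M)"
    using K by (auto simp: regular_ideal_def regular_elements_idealization)
  then have sK: "s \<in> fst ` K" by force
  then obtain Js where Js: "\<And>J. J \<in> set Js \<Longrightarrow> radical_ideal J R"
    "fst ` K = foldr (ideal_prod R) Js (carrier R)"
    using prod[OF ideal_fst_image[OF KI]] s(2) unfolding product_of_radical_ideals_def by blast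
  define Ks where "Ks = map (\<lambda>J. J \<times> carrier M) Js"
  have Ks_rad: "radical_ideal L Idn" if "L \<in> set Ks" for L
    using that Js(1) radical_ideal_times_carrier by (auto simp: Ks_def)
  \<comment> \<open>Each factor contains the product, hence the element \<open>s\<close>.\<close>
  have Ks_reg: "regular_ideal L Idn" if L: "L \<in> set Ks" for L
  proof -
    obtain J where J: "J \<in> set Js" "L = J \<times> carrier M" using L by (auto simp: Ks_def)
    have Js_ideal: "\<And>J. J \<in> set Js \<Longrightarrow> ideal J R" using Js(1) by (simp add: radical_ideal_def)
    obtain L' where "ideal L' R" "fst ` K = ideal_prod R J L'"
      using R.foldr_prod_factor[OF Js_ideal J(1)] Js(2) by auto
    then have "s \<in> J"
      using sK R.ideal_prod_inter[OF Js_ideal[OF J(1)]] by blast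
    then have "(s, \<zero>\<^bsub>M\<^esub>) \<in> L \<inter> regular_elements Idn"
      using J(2) s(2) by (simp add: regular_elements_idealization)
    then show ?thesis
      using Ks_rad[OF L] unfolding regular_ideal_def radical_ideal_def by blast
  qed
  let ?P = "foldr (ideal_prod Idn) Ks (carrier Idn)"
  have P: "regular_ideal ?P Idn" using Ks_reg by (rule Idn.regular_ideal_foldr_prod)
  have "map ((`) fst) Ks = Js"
    unfolding Ks_def map_map
    by (rule map_idI) (use M.zero_closed in force)
  moreover have "fst ` ?P = foldr (ideal_prod R) (map ((`) fst) Ks) (carrier R)"
    using Ks_rad by (intro fst_image_foldr_prod) (simp add: radical_ideal_def)
  ultimately have "fst ` ?P = fst ` K" using Js(2) by simp
  moreover have "?P = fst ` ?P \<times> carrier M"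
    using ideal_containing_module_eq_times divisible_regular_ideal_contains_module[OF P div] P
    by (simp add: regular_ideal_def)
  ultimately have "K = ?P" using Keq by simp
  then show "product_of_radical_ideals K Idn"
    unfolding product_of_radical_ideals_def using Ks_rad by blast
qed

end

theorem proposition2p4:
  fixes A :: "('a, 'm) ring_scheme" and M :: "('a, 'b, 'n) module_scheme" and S :: "'a set"
  assumes "Module.module A M"
    and "marot_ring A"
    and "marot_ring (idealization A M)"
    and "S = carrier A - (zerodivisors A \<union> module_zerodivisors A M)"
  shows "SP_ring (idealization A M) \<longleftrightarrow>
    (\<forall>I. ideal I A \<and> I \<inter> S \<noteq> {} \<longrightarrow> product_of_radical_ideals I A) \<and>
    (\<forall>s \<in> S. (\<lambda>x. s \<odot>\<^bsub>M\<^esub> x) ` carrier M = carrier M)"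
proof -
  interpret Module.module A M by (rule assms(1))
  show ?thesis
    unfolding assms(4)
    using SP_idealization_imp_product SP_idealization_imp_divisible divisible_imp_SP_idealization
    by blast
qed

end
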